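(* Let $\mathcal{X}\subset\mathbb{R}^d$ be an open subset, let $\mu:\mathcal{X}\to\mathbb{R}$ and $\sigma:\mathcal{X}\to(0,\infty)$ be functions, and let $l>0$. Let $k(\theta,\theta')=\frac{1}{\sqrt{2\pi l^2}}\exp\left(-\frac{(\theta-\theta')^2}{2l^2}\right)$ be the Gaussian kernel on $\mathbb{R}$ with reproducing kernel Hilbert space $\mathcal{H}_k$. For $x\in\mathcal{X}$ let $Q_x=\mathcal{N}(\mu(x),\sigma(x)^2)$ be the Gaussian distribution on $\mathbb{R}$ with mean $\mu(x)$ and variance $\sigma(x)^2$, and let $\phi_{Q_x}=\int_{\mathbb{R}}k(\cdot,\theta)\,dQ_x(\theta)\in\mathcal{H}_k$ be its kernel mean embedding. Define $$k_\pi(x,x')=\frac{1}{\sqrt{2\pi(l^2+\sigma(x)^2+\sigma(x')^2)}}\exp\left(-\frac{(\mu(x)-\mu(x'))^2}{2(l^2+\sigma(x)^2+\sigma(x')^2)}\right).$$ Then for all $x,x'\in\mathcal{X}$: $$k_\pi(x,x')=\langle\phi_{Q_x},\phi_{Q_{x'}}\rangle_{\mathcal{H}_k},\qquad k_\pi(x,x)=\|\phi_{Q_x}\|_{\mathcal{H}_k}^2=\frac{1}{\sqrt{2\pi(l^2+2\sigma(x)^2)}},$$ and $$\mathrm{MMD}^2(Q_x,Q_{x'},\mathcal{H}_k)=k_\pi(x,x)+k_\pi(x',x')-2k_\pi(x,x').$$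
   Context: For probability measures $D,T$ on $\mathbb{R}$ with kernel mean embeddings $\phi_D=\int k(\cdot,\theta)\,dD(\theta)$ and $\phi_T=\int k(\cdot,\theta)\,dT(\theta)$ in $\mathcal{H}_k$, the Maximum Mean Discrepancy is $$\mathrm{MMD}(D,T,\mathcal{H}_k):=\|\phi_D-\phi_T\|_{\mathcal{H}_k}=\sup_{f\in\mathcal{H}_k,\ \|f\|_{\mathcal{H}_k}\le 1}\left|\int f\,dD-\int f\,dT\right|.$$ *)

theory Defs
  imports "HOL-Probability.Probability"
begin

text \<open>
  A Hilbert space of functions on \<^typ>\<open>'x\<close> is a Hilbert space type \<^typ>\<open>'h\<close> together with an
  injective, pointwise linear map \<^term>\<open>evl\<close> sending each element to the function it is, so that
  \<^term>\<open>range evl\<close> is the space as a set of functions. It is the reproducing kernel Hilbert space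
  of \<^term>\<open>k\<close> when every \<open>k(\<cdot>, t)\<close> belongs to it and represents evaluation at \<^term>\<open>t\<close>. By the
  Moore-Aronszajn theorem such a space exists for every positive semidefinite kernel and is unique
  up to an isometry that commutes with \<^term>\<open>evl\<close>.
\<close>

definition is_rkhs ::
  "('x \<Rightarrow> 'x \<Rightarrow> real) \<Rightarrow> ('h::{real_inner, complete_space} \<Rightarrow> 'x \<Rightarrow> real) \<Rightarrow> bool" where
  "is_rkhs k evl \<longleftrightarrow>
     (\<forall>t. linear (\<lambda>f. evl f t)) \<and> inj evl \<and>
     (\<forall>t. \<exists>h. evl h = (\<lambda>s. k s t) \<and> (\<forall>f. evl f t = inner f h))"

definition kernel_section :: "('x \<Rightarrow> 'x \<Rightarrow> real) \<Rightarrow> ('h \<Rightarrow> 'x \<Rightarrow> real) \<Rightarrow> 'x \<Rightarrow> 'h" where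
  "kernel_section k evl t = (THE h. evl h = (\<lambda>s. k s t))"

text \<open>
  The Bochner integral is only available on second countable types. For a continuous kernel on the
  real line this is no restriction: the span of the sections at rational points, with rational
  coefficients, is dense in the reproducing kernel Hilbert space.
\<close>

definition kernel_mean ::
  "(real \<Rightarrow> real \<Rightarrow> real) \<Rightarrow> ('h::{real_inner, banach, second_countable_topology} \<Rightarrow> real \<Rightarrow> real)
     \<Rightarrow> real measure \<Rightarrow> 'h" where
  "kernel_mean k evl D = (\<integral>\<theta>. kernel_section k evl \<theta> \<partial>D)"

definition MMD ::
  "(real \<Rightarrow> real \<Rightarrow> real) \<Rightarrow> ('h::{real_inner, banach, second_countable_topology} \<Rightarrow> real \<Rightarrow> real)
     \<Rightarrow> real measure \<Rightarrow> real measure \<Rightarrow> real" where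
  "MMD k evl D T = norm (kernel_mean k evl D - kernel_mean k evl T)"

definition gaussian_kernel :: "real \<Rightarrow> real \<Rightarrow> real \<Rightarrow> real" where
  "gaussian_kernel l \<theta> \<theta>' =
     1 / sqrt (2 * pi * l\<^sup>2) * exp (- (\<theta> - \<theta>')\<^sup>2 / (2 * l\<^sup>2))"

text \<open>As in \<^const>\<open>normal_density\<close>, the second parameter is the standard deviation.\<close>

definition gaussian_measure :: "real \<Rightarrow> real \<Rightarrow> real measure" where
  "gaussian_measure m s = density lborel (\<lambda>\<theta>. ennreal (normal_density m s \<theta>))"

definition k_pi :: "real \<Rightarrow> ('x \<Rightarrow> real) \<Rightarrow> ('x \<Rightarrow> real) \<Rightarrow> 'x \<Rightarrow> 'x \<Rightarrow> real" where
  "k_pi l \<mu> \<sigma> x x' =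
     1 / sqrt (2 * pi * (l\<^sup>2 + (\<sigma> x)\<^sup>2 + (\<sigma> x')\<^sup>2)) *
     exp (- (\<mu> x - \<mu> x')\<^sup>2 / (2 * (l\<^sup>2 + (\<sigma> x)\<^sup>2 + (\<sigma> x')\<^sup>2)))"

end

theory Submission
  imports Defs
begin

text \<open>
  Every evaluation \<open>f(t)\<close> is the inner product of \<open>f\<close> with the section \<open>k(\<cdot>, t)\<close>, so sections
  satisfy \<open>\<langle>k(\<cdot>, s), k(\<cdot>, t)\<rangle> = k(s, t)\<close>. For the Gaussian kernel this makes all sections have the
  same norm and depend continuously on the point; hence they are Bochner integrable against every
  finite Borel measure (\<open>integrable_gaussian_kernel_section\<close>). The integral then commutes with the inner
  product, and \<open>\<langle>\<phi>\<^sub>D, \<phi>\<^sub>T\<rangle>\<close> becomes the iterated integral of the kernel.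

  The kernel \<open>k(s, t)\<close> is the density at \<open>t\<close> of a normal distribution with mean \<open>s\<close> and variance
  \<open>l\<^sup>2\<close>, so integrating it against a Gaussian measure is a convolution of normal densities: the
  variances add (\<open>normal_density_smoothing\<close>). Smoothing twice, with \<open>\<sigma>(x')\<^sup>2\<close> and \<open>\<sigma>(x)\<^sup>2\<close>, gives
  the formula for \<open>k\<^sub>\<pi>\<close>. The remaining claims are its diagonal case and the expansion of the
  squared norm of a difference.
\<close>

lemma
  assumes "is_rkhs k evl"
  shows evl_kernel_section: "evl (kernel_section k evl t) = (\<lambda>s. k s t)"
    and reproducing: "evl f t = inner f (kernel_section k evl t)"
proof -
  obtain h where h: "evl h = (\<lambda>s. k s t)" "\<And>f. evl f t = inner f h"
    using assms unfolding is_rkhs_def by blast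
  have "kernel_section k evl t = h"
    unfolding kernel_section_def
    using h(1) assms by (intro the_equality) (simp_all add: is_rkhs_def inj_eq[of evl, symmetric])
  with h show "evl (kernel_section k evl t) = (\<lambda>s. k s t)"
    and "evl f t = inner f (kernel_section k evl t)" by simp_all
qed

lemma inner_kernel_section:
  assumes "is_rkhs k evl"
  shows "inner (kernel_section k evl s) (kernel_section k evl t) = k t s"
  using reproducing[OF assms, of "kernel_section k evl s" t] evl_kernel_section[OF assms, of s]
  by simp

text \<open>
  Since \<open>\<parallel>k(\<cdot>, s) - k(\<cdot>, t)\<parallel>\<^sup>2 = k(s, s) - k(s, t) - k(t, s) + k(t, t)\<close>, continuity of the kernel
  passes to the sections.
\<close>

lemma continuous_kernel_section:
  fixes k :: "'x::topological_space \<Rightarrow> 'x \<Rightarrow> real"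
  assumes rkhs: "is_rkhs k evl"
    and cont: "continuous_on UNIV (\<lambda>(s, t). k s t)"
  shows "continuous_on UNIV (kernel_section k evl)"
proof -
  let ?S = "kernel_section k evl"
  have "(?S \<longlongrightarrow> ?S t) (at t)" for t
  proof -
    have along: "((\<lambda>s. k (f s) (g s)) \<longlongrightarrow> k (f t) (g t)) (at t)"
      if "continuous_on UNIV f" "continuous_on UNIV g" for f g :: "'x \<Rightarrow> 'x"
      using continuous_on_compose2[OF cont continuous_on_Pair[OF that]]
      by (simp add: continuous_on_def)
    have "((\<lambda>s. sqrt (k s s - k s t - k t s + k t t)) \<longlongrightarrow>
        sqrt (k t t - k t t - k t t + k t t)) (at t)"
      by (intro tendsto_intros along[of "\<lambda>s. s" "\<lambda>s. s"] along[of "\<lambda>s. s" "\<lambda>s. t"]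
          along[of "\<lambda>s. t" "\<lambda>s. s"]) (simp_all add: continuous_on_id continuous_on_const)
    moreover have "sqrt (k s s - k s t - k t s + k t t) = norm (?S s - ?S t)" for s
      by (simp add: norm_eq_sqrt_inner inner_diff_left inner_diff_right
          inner_kernel_section[OF rkhs] algebra_simps)
    ultimately have "((\<lambda>s. norm (?S s - ?S t)) \<longlongrightarrow> 0) (at t)" by simp
    then show ?thesis
      by (metis LIM_zero_cancel tendsto_norm_zero_cancel)
  qed
  then show ?thesis by (simp add: continuous_on_def)
qed

lemma gaussian_kernel_eq_normal_density: "gaussian_kernel l s t = normal_density s l t"
  by (simp add: gaussian_kernel_def normal_density_def power2_commute)

lemma sets_gaussian_measure [simp, measurable_cong]: "sets (gaussian_measure m s) = sets borel"
  by (simp add: gaussian_measure_def)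

lemma prob_space_gaussian_measure: "s > 0 \<Longrightarrow> prob_space (gaussian_measure m s)"
  unfolding gaussian_measure_def by (rule prob_space_normal_density)

text \<open>
  By symmetry and translation invariance of the density the integral is the convolution of two
  centred normal densities, taken at \<open>c - m\<close>.
\<close>

lemma normal_density_smoothing:
  assumes "l > 0" "s > 0"
  shows "(\<integral>t. normal_density c l t \<partial>gaussian_measure m s) = normal_density m (sqrt (l\<^sup>2 + s\<^sup>2)) c"
proof -
  have shift: "normal_density m s (m + y) * normal_density c l (m + y) =
      normal_density 0 l ((c - m) - y) * normal_density 0 s y" for y
  proof -
    have "((m + y) - c)\<^sup>2 = ((c - m) - y)\<^sup>2"
      by (simp add: power2_eq_square algebra_simps)
    then show ?thesis by (simp add: normal_density_def mult.commute)
  qed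
  have "(\<integral>\<^sup>+ t. ennreal (normal_density m s t * normal_density c l t) \<partial>lborel) =
      (\<integral>\<^sup>+ y. ennreal (normal_density 0 l ((c - m) - y) * normal_density 0 s y) \<partial>lborel)"
    by (subst nn_integral_real_affine[where c = 1 and t = m]) (simp_all add: shift)
  also have "\<dots> = ennreal (normal_density 0 (sqrt (l\<^sup>2 + s\<^sup>2)) (c - m))"
    using fun_cong[OF conv_normal_density_zero_mean[OF assms], of "c - m"] by simp
  also have "normal_density 0 (sqrt (l\<^sup>2 + s\<^sup>2)) (c - m) = normal_density m (sqrt (l\<^sup>2 + s\<^sup>2)) c"
    by (simp add: normal_density_def)
  finally have "(\<integral>t. normal_density m s t * normal_density c l t \<partial>lborel) =
      normal_density m (sqrt (l\<^sup>2 + s\<^sup>2)) c"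
    by (intro integral_eq_nn_integral[THEN trans]) auto
  then show ?thesis
    unfolding gaussian_measure_def by (subst integral_density) auto
qed

text \<open>
  Sections are bounded because \<open>k(t, t)\<close> is constant in \<open>t\<close>, and measurable because they are
  continuous in \<open>t\<close>.
\<close>

lemma integrable_gaussian_kernel_section:
  fixes evl :: "'h::{real_inner, banach, second_countable_topology} \<Rightarrow> real \<Rightarrow> real"
  assumes rkhs: "is_rkhs (gaussian_kernel l) evl"
    and "finite_measure M" "sets M = sets borel"
  shows "integrable M (kernel_section (gaussian_kernel l) evl)"
proof -
  interpret finite_measure M by fact
  note [measurable_cong] = \<open>sets M = sets borel\<close>
  have "continuous_on UNIV (\<lambda>(s, t). gaussian_kernel l s t)"
    unfolding gaussian_kernel_def case_prod_beta divide_inverse by (intro continuous_intros)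
  then have [measurable]: "kernel_section (gaussian_kernel l) evl \<in> borel_measurable borel"
    by (intro borel_measurable_continuous_onI continuous_kernel_section[OF rkhs])
  show ?thesis
    by (rule integrable_const_bound[where B = "sqrt (gaussian_kernel l 0 0)"])
      (simp_all add: norm_eq_sqrt_inner inner_kernel_section[OF rkhs] gaussian_kernel_def)
qed

lemma inner_kernel_mean_gaussian:
  fixes evl :: "'h::{real_inner, banach, second_countable_topology} \<Rightarrow> real \<Rightarrow> real"
  assumes rkhs: "is_rkhs (gaussian_kernel l) evl" and "l > 0" "s > 0" "s' > 0"
  shows "inner (kernel_mean (gaussian_kernel l) evl (gaussian_measure m s))
      (kernel_mean (gaussian_kernel l) evl (gaussian_measure m' s')) =
    normal_density m (sqrt (l\<^sup>2 + s\<^sup>2 + s'\<^sup>2)) m'"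
proof -
  let ?S = "kernel_section (gaussian_kernel l) evl"
  have int: "integrable (gaussian_measure a b) ?S" if "b > 0" for a b
    using integrable_gaussian_kernel_section[OF rkhs] prob_space_gaussian_measure[OF that]
    by (simp add: prob_space.finite_measure)
  have pointwise: "inner (?S t) (\<integral>t'. ?S t' \<partial>gaussian_measure m' s') =
      normal_density m' (sqrt (l\<^sup>2 + s'\<^sup>2)) t" for t
  proof -
    have "inner (?S t) (\<integral>t'. ?S t' \<partial>gaussian_measure m' s') =
        (\<integral>t'. inner (?S t) (?S t') \<partial>gaussian_measure m' s')"
      using int \<open>s' > 0\<close> by simp
    also have "\<dots> = (\<integral>t'. normal_density t l t' \<partial>gaussian_measure m' s')"
      by (simp add: inner_kernel_section[OF rkhs] gaussian_kernel_eq_normal_density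
          normal_density_def power2_commute)
    finally show ?thesis using assms by (simp add: normal_density_smoothing)
  qed
  have "inner (\<integral>t. ?S t \<partial>gaussian_measure m s) (\<integral>t'. ?S t' \<partial>gaussian_measure m' s') =
      (\<integral>t. normal_density m' (sqrt (l\<^sup>2 + s'\<^sup>2)) t \<partial>gaussian_measure m s)"
    using int[OF \<open>s > 0\<close>] by (subst integral_inner_left[symmetric]) (simp_all add: pointwise)
  also have "\<dots> = normal_density m (sqrt ((sqrt (l\<^sup>2 + s'\<^sup>2))\<^sup>2 + s\<^sup>2)) m'"
    using assms by (intro normal_density_smoothing) (auto simp: add_pos_pos)
  finally show ?thesis by (simp add: kernel_mean_def add_ac)
qed

theorem mainTheorem3:
  fixes X :: "(real ^ 'd) set"
    and \<mu> \<sigma> :: "real ^ 'd \<Rightarrow> real"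
    and l :: real
    and evl :: "'h::{real_inner, banach, second_countable_topology} \<Rightarrow> real \<Rightarrow> real"
    and Q :: "real ^ 'd \<Rightarrow> real measure"
    and \<phi> :: "real ^ 'd \<Rightarrow> 'h"
  assumes "open X"
    and "\<And>x. x \<in> X \<Longrightarrow> \<sigma> x > 0"
    and "l > 0"
    and "is_rkhs (gaussian_kernel l) evl"
  defines "Q \<equiv> (\<lambda>x. gaussian_measure (\<mu> x) (\<sigma> x))"
    and "\<phi> \<equiv> (\<lambda>x. kernel_mean (gaussian_kernel l) evl (Q x))"
  shows "\<forall>x\<in>X. \<forall>x'\<in>X.
      integrable (Q x) (kernel_section (gaussian_kernel l) evl) \<and>
      k_pi l \<mu> \<sigma> x x' = inner (\<phi> x) (\<phi> x') \<and>
      k_pi l \<mu> \<sigma> x x = (norm (\<phi> x))\<^sup>2 \<and>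
      (norm (\<phi> x))\<^sup>2 = 1 / sqrt (2 * pi * (l\<^sup>2 + 2 * (\<sigma> x)\<^sup>2)) \<and>
      (MMD (gaussian_kernel l) evl (Q x) (Q x'))\<^sup>2 =
        k_pi l \<mu> \<sigma> x x + k_pi l \<mu> \<sigma> x' x' - 2 * k_pi l \<mu> \<sigma> x x'"
proof (intro ballI conjI)
  fix x x' assume x: "x \<in> X" and x': "x' \<in> X"
  have inner_\<phi>: "inner (\<phi> y) (\<phi> y') = k_pi l \<mu> \<sigma> y y'" if "y \<in> X" "y' \<in> X" for y y'
    using inner_kernel_mean_gaussian[OF assms(4,3) assms(2)[OF that(1)] assms(2)[OF that(2)]]
    by (simp add: \<phi>_def Q_def k_pi_def normal_density_def power2_commute)
  show "integrable (Q x) (kernel_section (gaussian_kernel l) evl)"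
    using assms(2)[OF x] assms(4)
    by (simp add: Q_def integrable_gaussian_kernel_section prob_space_gaussian_measure
        prob_space.finite_measure)
  show "k_pi l \<mu> \<sigma> x x' = inner (\<phi> x) (\<phi> x')"
    using x x' by (simp add: inner_\<phi>)
  show norm_\<phi>: "k_pi l \<mu> \<sigma> x x = (norm (\<phi> x))\<^sup>2"
    using x by (simp add: inner_\<phi> power2_norm_eq_inner)
  show "(norm (\<phi> x))\<^sup>2 = 1 / sqrt (2 * pi * (l\<^sup>2 + 2 * (\<sigma> x)\<^sup>2))"
    by (simp add: norm_\<phi>[symmetric] k_pi_def)
  show "(MMD (gaussian_kernel l) evl (Q x) (Q x'))\<^sup>2 =
      k_pi l \<mu> \<sigma> x x + k_pi l \<mu> \<sigma> x' x' - 2 * k_pi l \<mu> \<sigma> x x'"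
    using x x' inner_commute[of "\<phi> x" "\<phi> x'"]
    by (simp add: MMD_def flip: \<phi>_def inner_\<phi>)
      (simp add: \<phi>_def power2_norm_eq_inner inner_diff_left inner_diff_right)
qed

end
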